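(* Let $(A,\omega)$ be a commutative baric $K$-algebra satisfying $2x^{2}x^{4}=\omega(x)^{2}x^{4}+\omega(x)^{4}x^{2}$ for all $x\in A$, with Peirce decomposition $A=Ke\oplus A_0\oplus A_{\frac12}\oplus A_{\lambda}\oplus A_{\bar\lambda}$ relative to a non-zero idempotent $e$. Then: (i) $A_0A_0\subset A_{\frac12}$; (ii) $A_{\frac12}A_{\frac12}\subset A_0\oplus A_\lambda\oplus A_{\bar\lambda}$; (iii) $A_\lambda A_{\bar\lambda}=0$; (iv) $A_\lambda A_\lambda=0$; (v) $A_{\bar\lambda}A_{\bar\lambda}=0$; (vi) $A_0A_{\frac12}\subset A_{\frac12}\oplus A_\lambda\oplus A_{\bar\lambda}$; (vii) $A_\lambda A_{\frac12}\subset A_{\frac12}\oplus A_0\oplus A_{\bar\lambda}$; (viii) $A_{\bar\lambda}A_{\frac12}\subset A_{\frac12}\oplus A_0\oplus A_{\lambda}$; (ix) $A_0A_\lambda\subset A_{\frac12}$; (x) $A_0A_{\bar\lambda}\subset A_{\frac12}$.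
   Context: $K$ is an algebraically closed (infinite, commutative) field of characteristic different from $2$. Algebras are commutative but not necessarily associative. A baric $K$-algebra $(A,\omega)$ is a $K$-algebra $A$ with a non-zero algebra homomorphism $\omega:A\to K$. Principal powers are $x^1=x$, $x^{k+1}=x\,x^{k}$. Here $\lambda=\frac{-1-i\sqrt{23}}{4}$, $\bar\lambda=\frac{-1+i\sqrt{23}}{4}$, where $i\sqrt{23}$ denotes a fixed square root of $-23$ in $K$, and for an idempotent $e$, $A_\alpha=\{x\in\ker\omega: ex=\alpha x\}$ for $\alpha\in\{0,\frac12,\lambda,\bar\lambda\}$.
   Formalization: Items (iii) and (iv), (v) fail in some characteristics, so (iii) is claimed only when the characteristic of K is not 5, and (iv) and (v) only when it is not 163; all other items are as stated for every characteristic different from 2. *)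

theory Defs
  imports "HOL-Computational_Algebra.Polynomial"
begin

text \<open>
  An algebra is carried by a whole type \<open>'a\<close>, with the scalar multiplication and the product given
  as functions. It is commutative, but need not be associative or have a unit.
\<close>

locale comm_algebra = vector_space scale
  for scale :: "'k::field \<Rightarrow> 'a::ab_group_add \<Rightarrow> 'a" +
  fixes mul :: "'a \<Rightarrow> 'a \<Rightarrow> 'a"
  assumes mul_linear: "Vector_Spaces.linear scale scale (mul x)"
    and mul_commute: "mul x y = mul y x"

locale baric_algebra = comm_algebra scale mul
  for scale :: "'k::field \<Rightarrow> 'a::ab_group_add \<Rightarrow> 'a" and mul :: "'a \<Rightarrow> 'a \<Rightarrow> 'a" +
  fixes \<omega> :: "'a \<Rightarrow> 'k"
  assumes weight_linear: "Vector_Spaces.linear scale (*) \<omega>"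
    and weight_mul: "\<omega> (mul x y) = \<omega> x * \<omega> y"
    and weight_nonzero: "\<exists>x. \<omega> x \<noteq> 0"

text \<open>Principal powers start at exponent 1; the value at exponent 0 is a dummy.\<close>

primrec principal_power :: "('a::zero \<Rightarrow> 'a \<Rightarrow> 'a) \<Rightarrow> 'a \<Rightarrow> nat \<Rightarrow> 'a" where
  "principal_power mul x 0 = 0"
| "principal_power mul x (Suc n) = (if n = 0 then x else mul x (principal_power mul x n))"

definition peirce_space ::
    "('k::zero \<Rightarrow> 'a \<Rightarrow> 'a) \<Rightarrow> ('a \<Rightarrow> 'a \<Rightarrow> 'a) \<Rightarrow> ('a \<Rightarrow> 'k) \<Rightarrow> 'a \<Rightarrow> 'k \<Rightarrow> 'a set" where
  "peirce_space scale mul \<omega> e \<alpha> = {x. \<omega> x = 0 \<and> mul e x = scale \<alpha> x}"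

text \<open>As usual, the product of two subspaces is the subspace spanned by the products.\<close>

definition subspace_product ::
    "('k::field \<Rightarrow> 'a::ab_group_add \<Rightarrow> 'a) \<Rightarrow> ('a \<Rightarrow> 'a \<Rightarrow> 'a) \<Rightarrow> 'a set \<Rightarrow> 'a set \<Rightarrow> 'a set" where
  "subspace_product scale mul U V = module.span scale {mul u v |u v. u \<in> U \<and> v \<in> V}"

text \<open>
  \<open>listset [U, V, \<dots>]\<close> is the set of lists \<open>[u, v, \<dots>]\<close> with \<open>u \<in> U\<close>, \<open>v \<in> V\<close>, \<dots>. Using a list of
  summands, not a set, keeps repeated summands apart: in a direct sum a summand that occurs
  twice must be zero. This matters in characteristics 3 and 23, where Peirce eigenvalues coincide.
\<close>

definition subspace_sum :: "'a::ab_group_add set list \<Rightarrow> 'a set" where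
  "subspace_sum Us = sum_list ` listset Us"

definition is_direct_sum :: "'a::ab_group_add set \<Rightarrow> 'a set list \<Rightarrow> bool" where
  "is_direct_sum W Us \<longleftrightarrow> bij_betw sum_list (listset Us) W"

end

theory Submission
  imports Defs
begin

text \<open>
  A generic point of the affine space of weight-one elements is \<open>e + t y\<close> with \<open>\<omega> y = 0\<close>.
  Inserted into the identity it gives a polynomial in \<open>t\<close> with coefficients in the algebra; it
  vanishes for all scalars \<open>t\<close>, and the field is infinite, so each coefficient vanishes. With
  \<open>L\<close> the multiplication by \<open>e\<close>, the coefficient of \<open>t\<close> only says that
  \<open>L (2L - 1) (2L\<^sup>2 + L + 3)\<close> kills the kernel of \<open>\<omega>\<close>, which is the origin of the Peirce
  eigenvalues. The product rules come from the coefficient of \<open>t\<^sup>2\<close>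
  (\<open>weighted_identity_second_order\<close>), which is quadratic in \<open>y\<close>. Polarized at eigenvectors \<open>u\<close>
  and \<open>v\<close> of \<open>L\<close> with eigenvalues \<open>\<alpha>\<close> and \<open>\<beta>\<close> it says that a polynomial in \<open>L\<close> of degree
  three, with coefficients depending on \<open>\<alpha>\<close> and \<open>\<beta>\<close> only, kills the product \<open>u v\<close>
  (\<open>weighted_identity_polarized\<close>). Call the value of this polynomial at \<open>\<gamma>\<close> the scalar
  \<open>fusion_poly \<alpha> \<beta> \<gamma>\<close>. As the Peirce sum is direct, the component of \<open>u v\<close> for the eigenvalue
  \<open>\<gamma>\<close> is zero unless \<open>fusion_poly \<alpha> \<beta> \<gamma> = 0\<close> (\<open>peirce_product_components\<close>).

  What remains is to see that certain values of \<open>fusion_poly\<close> are not zero. The two irrational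
  eigenvalues \<open>l\<close> and \<open>m\<close> enter only through \<open>l + m = -1/2\<close> and \<open>l m = 3/2\<close>; this data is
  symmetric, so each rule for \<open>l\<close> gives the one for \<open>m\<close>. A value of the form \<open>p + q l\<close> is
  nonzero as soon as its norm \<open>(p + q l) (p + q m)\<close>, a rational number, is nonzero in the field.
  The norms that occur are, up to powers of 2, products of the primes 3, 5, 23 and 163. In
  characteristic 5 the value that controls the \<open>A\<^sub>0\<close>-component of \<open>A\<^sub>l A\<^sub>m\<close> is zero, and in
  characteristic 163 so is the value for the \<open>A\<^sub>l\<close>-component of \<open>A\<^sub>l A\<^sub>l\<close> or the one for the
  \<open>A\<^sub>m\<close>-component of \<open>A\<^sub>m A\<^sub>m\<close>; the argument then says nothing about this component. In
  characteristic 3 and 23 two of the four eigenvalues coincide: either one of \<open>l\<close>,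
  \<open>m\<close> is zero, or \<open>l = m\<close>. Since the sum is direct as a sum of listed summands, a
  repeated summand is then zero (\<open>peirce_space_zero_if_eigenvalues_coincide\<close>), which settles these
  cases.
\<close>

section \<open>Polynomial identities with vector coefficients\<close>

text \<open>
  Otherwise the product of all linear factors, plus one, would be a polynomial without a root.
\<close>

lemma infinite_UNIV_alg_closed: "infinite (UNIV :: 'k::alg_closed_field set)"
proof
  assume fin: "finite (UNIV :: 'k set)"
  define p :: "'k poly" where "p = (\<Prod>a\<in>UNIV. [:- a, 1:])"
  have "degree p = card (UNIV :: 'k set)"
    unfolding p_def by (subst degree_prod_eq_sum_degree) auto
  then have "0 < degree p"
    using fin by (simp add: card_gt_0_iff)
  then have "0 < degree (p + 1)"
    by (simp add: degree_add_eq_left)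
  then obtain z where "poly (p + 1) z = 0"
    using alg_closed_imp_poly_has_root[of "p + 1"] by auto
  moreover have "poly p z = 0"
    using fin by (auto simp: p_def poly_prod)
  ultimately show False by simp
qed

lemma (in vector_space) linear_functional_separates:
  assumes "x \<noteq> 0"
  obtains f where "Vector_Spaces.linear scale (*) f" "f x = 1"
proof -
  interpret scalars: vector_space "(*) :: 'a \<Rightarrow> 'a \<Rightarrow> 'a"
    by unfold_locales (auto simp: algebra_simps)
  interpret pair: vector_space_pair scale "(*) :: 'a \<Rightarrow> 'a \<Rightarrow> 'a" ..
  have "independent {x}"
    using assms by simp
  then show thesis
    using pair.linear_independent_extend[of "{x}" "\<lambda>_. 1"] that by auto
qed

lemma (in vector_space) linear_functional_simps:
  assumes "Vector_Spaces.linear scale (*) f"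
  shows "f 0 = 0" "f (x + y) = f x + f y" "f (x - y) = f x - f y" "f (scale c x) = c * f x"
    "f (sum g I) = (\<Sum>i\<in>I. f (g i))"
  using module_hom_linearI[OF assms]
  by (simp_all add: module_hom.zero module_hom.add module_hom.diff module_hom.scale module_hom.sum)

text \<open>
  Linear functionals separate points, so an identity between vectors may be checked after applying
  an arbitrary functional. There it becomes an identity in a commutative ring, where the ring
  normalization is available.
\<close>

lemma (in vector_space) eq_by_linear_functionals:
  assumes "\<And>f. Vector_Spaces.linear scale (*) f \<Longrightarrow> f x = f y"
  shows "x = y"
proof (rule ccontr)
  assume "x \<noteq> y"
  then have "x - y \<noteq> 0" by simp
  then obtain f where lin: "Vector_Spaces.linear scale (*) f" and f: "f (x - y) = 1"
    using linear_functional_separates by blast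
  then show False
    using assms[OF lin] by (simp add: linear_functional_simps[OF lin])
qed

lemma (in vector_space) vector_polynomial_coefficients_zero:
  fixes n :: nat and c :: "nat \<Rightarrow> 'b"
  assumes inf: "infinite (UNIV :: 'a set)"
    and zero: "\<And>t. (\<Sum>i\<le>n. scale (t ^ i) (c i)) = 0"
    and i: "i \<le> n"
  shows "c i = 0"
proof (rule eq_by_linear_functionals)
  fix f assume lin: "Vector_Spaces.linear scale (*) f"
  define p where "p = (\<Sum>j\<le>n. monom (f (c j)) j)"
  have "poly p t = f (\<Sum>j\<le>n. scale (t ^ j) (c j))" for t
    by (simp add: p_def poly_sum poly_monom linear_functional_simps[OF lin] mult.commute)
  then have "poly p t = 0" for t
    by (simp add: zero linear_functional_simps[OF lin])
  then have "p = 0"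
    using poly_roots_finite[of p] inf by auto
  moreover have "coeff p i = f (c i)"
    using i by (simp add: p_def coeff_sum)
  ultimately show "f (c i) = f 0"
    by (simp add: linear_functional_simps[OF lin])
qed

section \<open>Products and sums of subspaces\<close>

lemma (in vector_space) subspace_product_subset:
  assumes "subspace W" "\<And>u v. u \<in> V1 \<Longrightarrow> v \<in> V2 \<Longrightarrow> mul u v \<in> W"
  shows "subspace_product scale mul V1 V2 \<subseteq> W"
  unfolding subspace_product_def using assms by (intro span_minimal) auto

lemma (in vector_space) subspace_product_eq_0:
  assumes "\<And>u v. u \<in> V1 \<Longrightarrow> v \<in> V2 \<Longrightarrow> mul u v = 0"
  shows "subspace_product scale mul V1 V2 = {0}"
proof
  show "subspace_product scale mul V1 V2 \<subseteq> {0}"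
    by (rule subspace_product_subset) (auto simp: assms)
  show "{0} \<subseteq> subspace_product scale mul V1 V2"
    by (simp add: subspace_product_def span_zero)
qed

lemma subspace_sum_Nil: "subspace_sum [] = {0}"
  by (simp add: subspace_sum_def)

lemma subspace_sum_Cons: "subspace_sum (V # Vs) = {x + y | x y. x \<in> V \<and> y \<in> subspace_sum Vs}"
  by (fastforce simp: subspace_sum_def set_Cons_def image_def)

lemma (in vector_space) subspace_subspace_sum:
  "(\<And>V. V \<in> set Vs \<Longrightarrow> subspace V) \<Longrightarrow> subspace (subspace_sum Vs)"
  by (induction Vs) (simp_all add: subspace_sum_Nil subspace_sum_Cons subspace_sums)

lemma sum_of_three_in_subspace_sum:
  assumes "x \<in> V1" "y \<in> V2" "z \<in> V3"
  shows "x + y + z \<in> subspace_sum [V1, V2, V3]"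
proof -
  have "[x, y, z] \<in> listset [V1, V2, V3]"
    using assms by (simp add: set_Cons_def)
  then have "sum_list [x, y, z] \<in> subspace_sum [V1, V2, V3]"
    unfolding subspace_sum_def by (rule imageI)
  then show ?thesis by (simp add: add.assoc)
qed

section \<open>The identity to second order at an idempotent\<close>

context comm_algebra
begin

lemma mul_add_right: "mul x (y + z) = mul x y + mul x z"
  using module_hom.add[OF module_hom_linearI[OF mul_linear]] .

lemma mul_scale_right: "mul x (scale c y) = scale c (mul x y)"
  using module_hom.scale[OF module_hom_linearI[OF mul_linear]] .

lemma mul_add_left: "mul (x + y) z = mul x z + mul y z"
  by (simp add: mul_commute[of _ z] mul_add_right)

lemma mul_scale_left: "mul (scale c x) y = scale c (mul x y)"
  by (simp add: mul_commute[of _ y] mul_scale_right)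

lemma mul_zero_right: "mul x 0 = 0"
  using mul_scale_right[of x 0 0] by simp

lemma mul_zero_left: "mul 0 x = 0"
  using mul_scale_left[of 0 0 x] by simp

lemmas mul_simps = mul_add_left mul_add_right mul_scale_left mul_scale_right

end

context baric_algebra
begin

lemma weight_add: "\<omega> (x + y) = \<omega> x + \<omega> y"
  using module_hom.add[OF module_hom_linearI[OF weight_linear]] .

lemma weight_scale: "\<omega> (scale c x) = c * \<omega> x"
  using module_hom.scale[OF module_hom_linearI[OF weight_linear]] .

lemma weight_zero: "\<omega> 0 = 0"
  using weight_scale[of 0 0] by simp

lemma subspace_peirce_space: "subspace (peirce_space scale mul \<omega> e \<alpha>)"
  by (auto simp: subspace_def peirce_space_def weight_zero weight_add weight_scale mul_simps
      mul_zero_right scale_right_distrib mult.commute)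

text \<open>
  The left-hand side is the coefficient of \<open>t\<^sup>2\<close> in the identity at \<open>x = e + t y\<close>. The letters \<open>a\<close>,
  \<open>b\<close>, \<open>d\<close> stand for the coefficients of the powers \<open>x\<^sup>2\<close>, \<open>x\<^sup>3\<close>, \<open>x\<^sup>4\<close>, and the index for the
  exponent of \<open>t\<close>; the constant coefficient of each power is \<open>e\<close>.
\<close>

lemma weighted_identity_second_order:
  assumes inf: "infinite (UNIV :: 'k set)"
    and identity: "\<And>x. scale 2 (mul (principal_power mul x 2) (principal_power mul x 4)) =
        scale (\<omega> x ^ 2) (principal_power mul x 4) + scale (\<omega> x ^ 4) (principal_power mul x 2)"
    and ee: "mul e e = e" and we: "\<omega> e = 1" and y: "\<omega> y = 0"
  defines "L \<equiv> mul e"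
  defines "b1 \<equiv> scale 2 (L (L y)) + L y"
  defines "d1 \<equiv> L b1 + L y"
    and "d2 \<equiv> L (L (mul y y)) + scale 2 (L (mul y (L y))) + mul y b1"
  shows "scale 2 (L d2) + scale 4 (mul (L y) d1) + scale 2 (L (mul y y)) - d2 - mul y y = 0"
proof -
  define a1 where "a1 = scale 2 (L y)"
  define a2 where "a2 = mul y y"
  define b2 where "b2 = L a2 + mul y a1"
  define b3 where "b3 = mul y a2"
  define d3 where "d3 = L b3 + mul y b2"
  define d4 where "d4 = mul y b3"
  \<comment> \<open>The coefficients of \<open>2 x\<^sup>2 x\<^sup>4 - x\<^sup>4 - x\<^sup>2\<close>, a polynomial of degree six in \<open>t\<close>.\<close>
  define c where "c = [0,
      scale 2 (L d1 + L a1) - d1 - a1,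
      scale 2 (L d2 + mul a1 d1 + L a2) - d2 - a2,
      scale 2 (L d3 + mul a1 d2 + mul a2 d1) - d3,
      scale 2 (L d4 + mul a1 d3 + mul a2 d2) - d4,
      scale 2 (mul a1 d4 + mul a2 d3),
      scale 2 (mul a2 d4)]"
  have "(\<Sum>i\<le>6. scale (t ^ i) (c ! i)) = 0" for t
  proof -
    define x where "x = e + scale t y"
    have wx: "\<omega> x = 1"
      by (simp add: x_def weight_add weight_scale we y)
    have comm: "mul y e = L y" "\<And>z. mul z e = L z" "L e = e"
        "\<And>z z'. L (z + z') = L z + L z'" "\<And>r z. L (scale r z) = scale r (L z)"
      by (simp_all add: L_def mul_commute ee mul_simps)
    have x2: "principal_power mul x 2 = e + scale t a1 + scale (t ^ 2) a2"
    proof (rule eq_by_linear_functionals)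
      fix f assume lin: "Vector_Spaces.linear scale (*) f"
      show "f (principal_power mul x 2) = f (e + scale t a1 + scale (t ^ 2) a2)"
        by (simp add: eval_nat_numeral x_def a1_def a2_def mul_simps ee comm L_def[symmetric]
            linear_functional_simps[OF lin]) algebra
    qed
    have x3: "principal_power mul x 3 = e + scale t b1 + scale (t ^ 2) b2 + scale (t ^ 3) b3"
    proof -
      have "principal_power mul x 3 = mul x (principal_power mul x 2)"
        by (simp add: eval_nat_numeral)
      also have "\<dots> = e + scale t b1 + scale (t ^ 2) b2 + scale (t ^ 3) b3"
      proof (rule eq_by_linear_functionals)
        fix f assume lin: "Vector_Spaces.linear scale (*) f"
        show "f (mul x (principal_power mul x 2)) = f (e + scale t b1 + scale (t ^ 2) b2 + scale (t ^ 3) b3)"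
          unfolding x2
          by (simp add: x_def b1_def b2_def b3_def a1_def mul_simps ee comm L_def[symmetric]
              linear_functional_simps[OF lin]) algebra
      qed
      finally show ?thesis .
    qed
    have x4: "principal_power mul x 4 =
        e + scale t d1 + scale (t ^ 2) d2 + scale (t ^ 3) d3 + scale (t ^ 4) d4"
    proof -
      have "principal_power mul x 4 = mul x (principal_power mul x 3)"
        by (simp add: eval_nat_numeral)
      also have "\<dots> = e + scale t d1 + scale (t ^ 2) d2 + scale (t ^ 3) d3 + scale (t ^ 4) d4"
      proof (rule eq_by_linear_functionals)
        fix f assume lin: "Vector_Spaces.linear scale (*) f"
        show "f (mul x (principal_power mul x 3)) =
            f (e + scale t d1 + scale (t ^ 2) d2 + scale (t ^ 3) d3 + scale (t ^ 4) d4)"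
          unfolding x3
          by (simp add: x_def d1_def d2_def d3_def d4_def b2_def a1_def a2_def mul_simps ee
              comm L_def[symmetric]
              linear_functional_simps[OF lin]) algebra
      qed
      finally show ?thesis .
    qed
    have "scale 2 (mul (principal_power mul x 2) (principal_power mul x 4)) -
        principal_power mul x 4 - principal_power mul x 2 = 0"
      using identity[of x] by (simp add: wx)
    moreover have "(\<Sum>i\<le>6. scale (t ^ i) (c ! i)) =
        scale 2 (mul (principal_power mul x 2) (principal_power mul x 4)) -
        principal_power mul x 4 - principal_power mul x 2"
    proof (rule eq_by_linear_functionals)
      fix f assume lin: "Vector_Spaces.linear scale (*) f"
      have split: "(\<Sum>i\<le>6. g i) = g 0 + g 1 + g 2 + g 3 + g 4 + g 5 + g (6::nat)"
        for g :: "nat \<Rightarrow> 'k"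
        by (simp add: eval_nat_numeral)
      show "f (\<Sum>i\<le>6. scale (t ^ i) (c ! i)) =
          f (scale 2 (mul (principal_power mul x 2) (principal_power mul x 4)) -
          principal_power mul x 4 - principal_power mul x 2)"
        unfolding x2 x4
        by (simp add: linear_functional_simps[OF lin] split)
          (simp add: c_def mul_simps ee comm L_def[symmetric] linear_functional_simps[OF lin], algebra)
    qed
    ultimately show ?thesis by simp
  qed
  then have "c ! 2 = 0"
    by (rule vector_polynomial_coefficients_zero[OF inf]) simp
  then show ?thesis
    by (simp add: c_def a1_def a2_def mul_simps scale_right_distrib)
qed

text \<open>
  If \<open>Q y\<close> is the quadratic expression of the previous lemma, then \<open>Q (u + v) - Q u - Q v = 0\<close>. For
  eigenvectors \<open>u\<close>, \<open>v\<close> each mixed term is a power of \<open>L\<close> applied to \<open>w = u v\<close>, times a scalar. The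
  factor \<open>\<alpha> (2\<beta>\<^sup>3 + \<beta>\<^sup>2 + \<beta>) + \<beta> (2\<alpha>\<^sup>3 + \<alpha>\<^sup>2 + \<alpha>)\<close> that comes from \<open>(L y) (2L\<^sup>3 + L\<^sup>2 + L) y\<close> is
  \<open>\<alpha> \<beta> \<kappa>\<close>, with the same \<open>\<kappa>\<close> that is the constant coefficient inside \<open>z\<close>. All other terms
  together are \<open>(2L - 1) z\<close>.
\<close>

lemma weighted_identity_polarized:
  assumes inf: "infinite (UNIV :: 'k set)"
    and identity: "\<And>x. scale 2 (mul (principal_power mul x 2) (principal_power mul x 4)) =
        scale (\<omega> x ^ 2) (principal_power mul x 4) + scale (\<omega> x ^ 4) (principal_power mul x 2)"
    and ee: "mul e e = e" and we: "\<omega> e = 1"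
    and u: "u \<in> peirce_space scale mul \<omega> e \<alpha>" and v: "v \<in> peirce_space scale mul \<omega> e \<beta>"
  defines "w \<equiv> mul u v"
    and "\<kappa> \<equiv> 2 * \<alpha>\<^sup>2 + \<alpha> + 2 * \<beta>\<^sup>2 + \<beta> + 2"
  defines "z \<equiv> scale 2 (mul e (mul e w)) + scale (2 * (\<alpha> + \<beta>)) (mul e w) + scale \<kappa> w"
  shows "scale 2 (mul e z) - z + scale (4 * \<alpha> * \<beta> * \<kappa>) w = 0"
proof -
  have eig: "mul e u = scale \<alpha> u" "mul e v = scale \<beta> v" "\<omega> u = 0" "\<omega> v = 0" "\<omega> (u + v) = 0"
    using u v by (auto simp: peirce_space_def weight_add)
  note Q = weighted_identity_second_order[OF inf identity ee we]
  show ?thesis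
  proof (rule eq_by_linear_functionals)
    fix f assume lin: "Vector_Spaces.linear scale (*) f"
    note F = arg_cong[where f=f, OF Q]
    note S = eig mul_commute[of v u] mul_simps linear_functional_simps[OF lin]
    show "f (scale 2 (mul e z) - z + scale (4 * \<alpha> * \<beta> * \<kappa>) w) = f 0"
      using F[of "u + v"] F[of u] F[of v]
      by (simp add: S w_def z_def \<kappa>_def) algebra
  qed
qed

end

section \<open>Components of products of Peirce vectors\<close>

text \<open>
  The eigenvalue on \<open>A\<^sub>\<gamma>\<close> of the operator that, by \<open>weighted_identity_polarized\<close>, kills every product of a
  vector of \<open>A\<^sub>\<alpha>\<close> with a vector of \<open>A\<^sub>\<beta>\<close>.
\<close>

definition fusion_poly :: "'k::field \<Rightarrow> 'k \<Rightarrow> 'k \<Rightarrow> 'k" where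
  "fusion_poly \<alpha> \<beta> \<gamma> = (let \<kappa> = 2 * \<alpha>\<^sup>2 + \<alpha> + 2 * \<beta>\<^sup>2 + \<beta> + 2 in
     (2 * \<gamma> - 1) * (2 * \<gamma>\<^sup>2 + 2 * (\<alpha> + \<beta>) * \<gamma> + \<kappa>) + 4 * \<alpha> * \<beta> * \<kappa>)"

lemma fusion_poly_commute: "fusion_poly \<alpha> \<beta> \<gamma> = fusion_poly \<beta> \<alpha> \<gamma>"
  by (simp add: fusion_poly_def Let_def ac_simps)

lemma fusion_poly_0_left:
  "fusion_poly 0 \<beta> \<gamma> = (2 * \<gamma> - 1) * (2 * \<gamma>\<^sup>2 + 2 * \<beta> * \<gamma> + (2 * \<beta>\<^sup>2 + \<beta> + 2))"
  by (simp add: fusion_poly_def)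

lemma fusion_poly_at_0:
  "fusion_poly \<alpha> \<beta> 0 = (4 * \<alpha> * \<beta> - 1) * (2 * \<alpha>\<^sup>2 + \<alpha> + 2 * \<beta>\<^sup>2 + \<beta> + 2)"
  by (simp add: fusion_poly_def Let_def algebra_simps)

text \<open>
  The square root of \<open>-23\<close> is replaced by the sum and the product of the two eigenvalues that it
  defines. These assumptions are symmetric in \<open>l\<close> and \<open>m\<close>, so that exchanging the two gives another
  instance of the locale.
\<close>

locale peirce_decomposed_algebra = baric_algebra scale mul \<omega>
  for scale :: "'k::field \<Rightarrow> 'a::ab_group_add \<Rightarrow> 'a" and mul :: "'a \<Rightarrow> 'a \<Rightarrow> 'a"
    and \<omega> :: "'a \<Rightarrow> 'k" +
  fixes e :: 'a and l m :: 'k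
  assumes two: "(2 :: 'k) \<noteq> 0"
    and infinite_scalars: "infinite (UNIV :: 'k set)"
    and weighted_identity: "\<And>x. scale 2 (mul (principal_power mul x 2) (principal_power mul x 4)) =
        scale (\<omega> x ^ 2) (principal_power mul x 4) + scale (\<omega> x ^ 4) (principal_power mul x 2)"
    and idem: "mul e e = e" and weight_idem: "\<omega> e = 1"
    and eigenvalue_sum: "2 * (l + m) = -1" and eigenvalue_prod: "2 * (l * m) = 3"
    and kernel_decomposition: "\<And>x. \<omega> x = 0 \<Longrightarrow> \<exists>a b c d. x = a + b + c + d \<and>
        a \<in> peirce_space scale mul \<omega> e 0 \<and> b \<in> peirce_space scale mul \<omega> e (1/2) \<and>
        c \<in> peirce_space scale mul \<omega> e l \<and> d \<in> peirce_space scale mul \<omega> e m"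
    and independence: "\<And>a b c d. a + b + c + d = 0 \<Longrightarrow>
        a \<in> peirce_space scale mul \<omega> e 0 \<Longrightarrow> b \<in> peirce_space scale mul \<omega> e (1/2) \<Longrightarrow>
        c \<in> peirce_space scale mul \<omega> e l \<Longrightarrow> d \<in> peirce_space scale mul \<omega> e m \<Longrightarrow>
        a = 0 \<and> b = 0 \<and> c = 0 \<and> d = 0"
begin

abbreviation U :: "'k \<Rightarrow> 'a set" where
  "U \<equiv> peirce_space scale mul \<omega> e"

lemma peirce_decomposed_algebra_swap: "peirce_decomposed_algebra scale mul \<omega> e m l"
proof unfold_locales
  show "2 * (m + l) = -1" "2 * (m * l) = 3"
    using eigenvalue_sum eigenvalue_prod by (simp_all add: ac_simps)
  show "\<exists>a b c d. x = a + b + c + d \<and> a \<in> U 0 \<and> b \<in> U (1/2) \<and> c \<in> U m \<and> d \<in> U l"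
    if x: "\<omega> x = 0" for x
  proof -
    obtain a b c d where "x = a + b + c + d" and mem: "a \<in> U 0" "b \<in> U (1/2)" "c \<in> U l" "d \<in> U m"
      using kernel_decomposition[OF x] by blast
    then have "x = a + b + d + c"
      by (simp add: ac_simps)
    with mem show ?thesis by blast
  qed
  show "a = 0 \<and> b = 0 \<and> c = 0 \<and> d = 0"
    if "a + b + c + d = 0" "a \<in> U 0" "b \<in> U (1/2)" "c \<in> U m" "d \<in> U l" for a b c d
    using independence[of a b d c] that by (simp add: ac_simps)
qed (use two infinite_scalars weighted_identity idem weight_idem in simp_all)

lemma scale_mem: "x \<in> U \<gamma> \<Longrightarrow> scale c x \<in> U \<gamma>"
  using subspace_peirce_space by (rule subspace_scale)

lemma zero_mem: "0 \<in> U \<gamma>"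
  using subspace_peirce_space by (rule subspace_0)

lemma peirce_product_components:
  assumes u: "u \<in> U \<alpha>" and v: "v \<in> U \<beta>"
  shows "\<exists>a\<in>U 0. \<exists>b\<in>U (1/2). \<exists>c\<in>U l. \<exists>d\<in>U m. mul u v = a + b + c + d \<and>
    (fusion_poly \<alpha> \<beta> 0 = 0 \<or> a = 0) \<and> (fusion_poly \<alpha> \<beta> (1/2) = 0 \<or> b = 0) \<and>
    (fusion_poly \<alpha> \<beta> l = 0 \<or> c = 0) \<and> (fusion_poly \<alpha> \<beta> m = 0 \<or> d = 0)"
proof -
  have "\<omega> (mul u v) = 0"
    using u by (simp add: weight_mul peirce_space_def)
  then obtain a b c d where w: "mul u v = a + b + c + d"
    and mem: "a \<in> U 0" "b \<in> U (1/2)" "c \<in> U l" "d \<in> U m"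
    using kernel_decomposition by blast
  have eig: "mul e a = scale 0 a" "mul e b = scale (1/2) b" "mul e c = scale l c" "mul e d = scale m d"
    using mem by (auto simp: peirce_space_def)
  note polarized = weighted_identity_polarized[OF infinite_scalars weighted_identity idem weight_idem u v]
  let ?F = "fusion_poly \<alpha> \<beta>"
  have "scale (?F 0) a + scale (?F (1/2)) b + scale (?F l) c + scale (?F m) d = 0"
  proof (rule eq_by_linear_functionals)
    fix f assume lin: "Vector_Spaces.linear scale (*) f"
    \<comment> \<open>Naming the eigenvalue \<open>1/2\<close> keeps fractions out of the ring identity, which holds for any \<open>h\<close>.\<close>
    define h :: 'k where "h = 1/2"
    have eig': "mul e b = scale h b"
      using eig h_def by simp
    show "f (scale (?F 0) a + scale (?F (1/2)) b + scale (?F l) c + scale (?F m) d) = f 0"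
      using arg_cong[where f=f, OF polarized] unfolding w h_def[symmetric]
      by (simp add: eig(1,3,4) eig' mul_simps linear_functional_simps[OF lin] fusion_poly_def Let_def) algebra
  qed
  from independence[OF this] mem
  have "scale (?F 0) a = 0" "scale (?F (1/2)) b = 0" "scale (?F l) c = 0" "scale (?F m) d = 0"
    by (simp_all add: scale_mem)
  then show ?thesis
    using w by (intro bexI[OF _ mem(1)] bexI[OF _ mem(2)] bexI[OF _ mem(3)] bexI[OF _ mem(4)]) simp
qed

text \<open>
  If two of the four summands are the same space, then \<open>x\<close> in one of them and \<open>- x\<close> in the other
  add up to zero, and independence forces \<open>x = 0\<close>.
\<close>

lemma peirce_space_zero_if_eigenvalues_coincide:
  shows "l = 0 \<or> m = 0 \<Longrightarrow> x \<in> U 0 \<Longrightarrow> x = 0"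
    and "l = 0 \<or> l = m \<Longrightarrow> x \<in> U l \<Longrightarrow> x = 0"
    and "m = 0 \<or> l = m \<Longrightarrow> x \<in> U m \<Longrightarrow> x = 0"
proof -
  have neg: "- x \<in> U \<gamma>" if "x \<in> U \<gamma>" for \<gamma>
    using that subspace_peirce_space by (rule subspace_neg[rotated])
  show "x = 0" if "l = 0 \<or> m = 0" "x \<in> U 0"
    using that independence[of x 0 "- x" 0] independence[of x 0 0 "- x"] zero_mem neg by auto
  show "x = 0" if "l = 0 \<or> l = m" "x \<in> U l"
    using that independence[of "- x" 0 x 0] independence[of 0 0 x "- x"] zero_mem neg by auto
  show "x = 0" if "m = 0 \<or> l = m" "x \<in> U m"
    using that independence[of "- x" 0 0 x] independence[of 0 0 "- x" x] zero_mem neg by auto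
qed

section \<open>Nonvanishing of the relevant polynomial values\<close>

lemma numerals_nonzero: "(4 :: 'k) \<noteq> 0" "(8 :: 'k) \<noteq> 0"
proof -
  have "(4 :: 'k) = 2 * 2" "(8 :: 'k) = 2 * 2 * 2" by simp_all
  then show "(4 :: 'k) \<noteq> 0" "(8 :: 'k) \<noteq> 0"
    using two by (metis mult_eq_0_iff)+
qed

text \<open>
  This is where characteristic 3 is reduced to the case of a repeated eigenvalue.
\<close>

lemma eigenvalue_zero_if_three_zero: "(3 :: 'k) = 0 \<Longrightarrow> l = 0 \<or> m = 0"
  using eigenvalue_prod two by auto

lemma eigenvalue_poly: "2 * l\<^sup>2 = - l - 3" "2 * m\<^sup>2 = - m - 3"
  using eigenvalue_sum eigenvalue_prod by algebra+

lemma m_eq: "2 * m = - 1 - 2 * l"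
  using eigenvalue_sum by algebra

lemma fusion_poly_at_half:
  "fusion_poly (\<alpha> :: 'k) \<beta> (1/2) = 4 * \<alpha> * \<beta> * (2 * \<alpha>\<^sup>2 + \<alpha> + 2 * \<beta>\<^sup>2 + \<beta> + 2)"
  using two by (simp add: fusion_poly_def)

lemma fusion_poly_0_0_nonzero:
  "fusion_poly 0 0 (0 :: 'k) \<noteq> 0" "fusion_poly 0 0 l \<noteq> 0"
proof -
  have "fusion_poly 0 0 (0 :: 'k) = -2" by (simp add: fusion_poly_def)
  then show "fusion_poly 0 0 (0 :: 'k) \<noteq> 0" using two by simp
  have "fusion_poly 0 0 l = (2 * l - 1) * (2 * l\<^sup>2 + 2)"
    by (simp add: fusion_poly_def)
  also have "\<dots> = 4"
    using eigenvalue_poly(1) by algebra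
  finally show "fusion_poly 0 0 l \<noteq> 0" using numerals_nonzero by simp
qed

lemma fusion_poly_half_half_nonzero: "fusion_poly (1/2) (1/2) (1/2 :: 'k) \<noteq> 0"
proof -
  define h :: 'k where "h = 1/2"
  have "2 * h = 1" using two by (simp add: h_def)
  then have "fusion_poly h h h = 4"
    unfolding fusion_poly_def Let_def by algebra
  then show ?thesis using numerals_nonzero by (simp add: h_def)
qed

lemma fusion_poly_0_half_at_0: "fusion_poly 0 (1/2) (0 :: 'k) = -3"
proof -
  define h :: 'k where "h = 1/2"
  have "2 * h = 1" using two by (simp add: h_def)
  then have "- (2 * h\<^sup>2 + h + 2) = -3"
    by algebra
  then show ?thesis by (simp add: h_def fusion_poly_def)
qed

lemma two_l_neq_1: "2 * l \<noteq> 1"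
proof
  assume "2 * l = 1"
  \<comment> \<open>This is \<open>2 l\<^sup>2 + l + 3 = 0\<close>, rewritten to expose the factor.\<close>
  moreover have "(2 * l - 1) * (l + 1) = - 4"
    using eigenvalue_poly(1) by algebra
  ultimately show False using numerals_nonzero by simp
qed

text \<open>
  For \<open>\<alpha> = l\<close>, \<open>\<beta> = 1/2\<close> the constant \<open>\<kappa>\<close> is zero, so the polynomial factors completely, with roots
  \<open>0\<close>, \<open>1/2\<close> and \<open>m\<close>. The value at \<open>l\<close> vanishes only if \<open>l\<close> coincides with one of them.
\<close>

lemma fusion_poly_l_half_nonzero:
  assumes "l \<noteq> 0" "l \<noteq> m"
  shows "fusion_poly l (1/2) l \<noteq> 0"
proof -
  define h :: 'k where "h = 1/2"
  have "2 * h = 1" using two by (simp add: h_def)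
  then have "fusion_poly l h l = 2 * l * (2 * l - 1) * (l - m)"
    unfolding fusion_poly_def Let_def using eigenvalue_poly(1) m_eq by algebra
  then show ?thesis using assms two two_l_neq_1 by (simp add: h_def)
qed

lemma fusion_poly_0_l_nonzero:
  shows "fusion_poly 0 l 0 \<noteq> 0" "m \<noteq> 0 \<Longrightarrow> fusion_poly 0 l l \<noteq> 0" "fusion_poly 0 l m \<noteq> 0"
proof -
  have "fusion_poly 0 l 0 = - (2 * l\<^sup>2 + l + 2)"
    by (simp add: fusion_poly_def)
  also have "\<dots> = 1"
    using eigenvalue_poly(1) by algebra
  finally show "fusion_poly 0 l 0 \<noteq> 0" by simp
  have "fusion_poly 0 l l = - 2 * m * (2 * l - 1) ^ 2"
    unfolding fusion_poly_0_left using eigenvalue_poly(1) m_eq by algebra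
  then show "m \<noteq> 0 \<Longrightarrow> fusion_poly 0 l l \<noteq> 0" using two two_l_neq_1 by simp
  have "fusion_poly 0 l m = 4"
    unfolding fusion_poly_0_left using eigenvalue_poly eigenvalue_sum eigenvalue_prod by algebra
  then show "fusion_poly 0 l m \<noteq> 0" using numerals_nonzero by simp
qed

text \<open>
  At \<open>l\<close> the value is \<open>- (10 l + 11)\<close>, whose norm \<open>216\<close> has no prime factors except 2 and 3.
  The value at \<open>0\<close> is \<open>-20\<close>, which is the reason for excluding characteristic 5.
\<close>

lemma fusion_poly_l_m_nonzero:
  shows "(5::'k) \<noteq> 0 \<Longrightarrow> fusion_poly l m 0 \<noteq> 0"
    "(3::'k) \<noteq> 0 \<Longrightarrow> fusion_poly l m (1/2) \<noteq> 0"
    "(3::'k) \<noteq> 0 \<Longrightarrow> fusion_poly l m l \<noteq> 0"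
proof -
  have \<kappa>: "2 * l\<^sup>2 + l + 2 * m\<^sup>2 + m + 2 = - 4"
    using eigenvalue_poly by algebra
  have "4 * l * m = 2 * (2 * (l * m))" by simp
  then have lm4: "4 * l * m = 6"
    by (simp add: eigenvalue_prod)
  have "fusion_poly l m 0 = 4 * -5"
    unfolding fusion_poly_at_0 \<kappa> using lm4 by simp
  then show "(5::'k) \<noteq> 0 \<Longrightarrow> fusion_poly l m 0 \<noteq> 0"
    using numerals_nonzero by (metis mult_eq_0_iff neg_equal_0_iff_equal)
  have "fusion_poly l m (1/2) = 4 * l * m * -4"
    unfolding fusion_poly_at_half \<kappa> ..
  also have "\<dots> = - 8 * 3"
    by (simp add: lm4)
  finally show "(3::'k) \<noteq> 0 \<Longrightarrow> fusion_poly l m (1/2) \<noteq> 0"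
    using numerals_nonzero by (metis mult_eq_0_iff neg_equal_0_iff_equal)
  have "fusion_poly l m l = - (10 * l + 11)"
    unfolding fusion_poly_def Let_def \<kappa> using eigenvalue_poly(1) eigenvalue_sum eigenvalue_prod by algebra
  moreover have "(10 * l + 11) * (10 * m + 11) = 8 * 3 * 3 * 3"
    using eigenvalue_sum eigenvalue_prod by algebra
  ultimately show "(3::'k) \<noteq> 0 \<Longrightarrow> fusion_poly l m l \<noteq> 0"
    using numerals_nonzero by (metis mult_eq_0_iff neg_equal_0_iff_equal)
qed

text \<open>
  All four values are even multiples of a linear expression in \<open>l\<close>, with norms \<open>48\<close> for \<open>2 l + 7\<close>,
  \<open>9\<close> for \<open>l + 3\<close>, and \<open>4 * 163\<close> for \<open>23 - 6 l\<close>. The prime 163 comes from the last one. For \<open>l + 3\<close> the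
  assumption \<open>l \<noteq> 0\<close> is enough: if \<open>l + 3 = 0\<close>, then \<open>9 = 0\<close>, so \<open>3 = 0\<close> and \<open>l = 0\<close>.
\<close>

lemma fusion_poly_l_l_nonzero:
  shows "(3::'k) \<noteq> 0 \<Longrightarrow> fusion_poly l l 0 \<noteq> 0"
    "l \<noteq> 0 \<Longrightarrow> fusion_poly l l (1/2) \<noteq> 0"
    "(3::'k) \<noteq> 0 \<Longrightarrow> fusion_poly l l m \<noteq> 0"
    "(163::'k) \<noteq> 0 \<Longrightarrow> fusion_poly l l l \<noteq> 0"
proof -
  have \<kappa>: "2 * l\<^sup>2 + l + 2 * l\<^sup>2 + l + 2 = - 4"
    using eigenvalue_poly by algebra
  have n7: "(2 * l + 7) * (2 * m + 7) = 4 * 4 * 3"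
    using eigenvalue_sum eigenvalue_prod by algebra
  have "fusion_poly l l 0 = 4 * (2 * l + 7)"
    unfolding fusion_poly_at_0 \<kappa> using eigenvalue_poly(1) by algebra
  with n7 show "(3::'k) \<noteq> 0 \<Longrightarrow> fusion_poly l l 0 \<noteq> 0"
    using numerals_nonzero by (metis mult_eq_0_iff)
  have "fusion_poly l l m = 4 * (2 * l + 7)"
    unfolding fusion_poly_def Let_def \<kappa>
    using eigenvalue_poly eigenvalue_sum eigenvalue_prod by algebra
  with n7 show "(3::'k) \<noteq> 0 \<Longrightarrow> fusion_poly l l m \<noteq> 0"
    using numerals_nonzero by (metis mult_eq_0_iff)
  have "fusion_poly l l (1/2) = 8 * (l + 3)"
    unfolding fusion_poly_at_half \<kappa> using eigenvalue_poly(1) by algebra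
  moreover have "(l + 3) * (m + 3) = 3 * 3"
  proof -
    have "2 * ((l + 3) * (m + 3)) = 2 * (3 * 3)"
      using eigenvalue_sum eigenvalue_prod by algebra
    then show ?thesis using two by (metis mult_left_cancel)
  qed
  ultimately show "fusion_poly l l (1/2) \<noteq> 0" if "l \<noteq> 0"
    using that numerals_nonzero by (metis add.right_neutral mult_eq_0_iff)
  have "fusion_poly l l l = 2 * (23 - 6 * l)"
    unfolding fusion_poly_def Let_def \<kappa> using eigenvalue_poly(1) by algebra
  moreover have "(23 - 6 * l) * (23 - 6 * m) = 4 * 163"
    using eigenvalue_sum eigenvalue_prod by algebra
  ultimately show "(163::'k) \<noteq> 0 \<Longrightarrow> fusion_poly l l l \<noteq> 0"
    using numerals_nonzero two by (metis mult_eq_0_iff)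
qed

section \<open>The multiplication rules\<close>

lemma product_in_U_half:
  assumes u: "u \<in> U \<alpha>" and v: "v \<in> U \<beta>"
    and "fusion_poly \<alpha> \<beta> 0 \<noteq> 0" "fusion_poly \<alpha> \<beta> l \<noteq> 0" "fusion_poly \<alpha> \<beta> m \<noteq> 0"
  shows "mul u v \<in> U (1/2)"
proof -
  obtain a b c d where "mul u v = a + b + c + d" "b \<in> U (1/2)"
    "fusion_poly \<alpha> \<beta> 0 = 0 \<or> a = 0" "fusion_poly \<alpha> \<beta> l = 0 \<or> c = 0" "fusion_poly \<alpha> \<beta> m = 0 \<or> d = 0"
    using peirce_product_components[OF u v] by blast
  with assms show ?thesis by simp
qed

lemma product_0_0:
  assumes u: "u \<in> U 0" and v: "v \<in> U 0"
  shows "mul u v \<in> U (1/2)"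
proof -
  interpret swap: peirce_decomposed_algebra scale mul \<omega> e m l
    by (rule peirce_decomposed_algebra_swap)
  show ?thesis
    by (rule product_in_U_half[OF u v]) (fact fusion_poly_0_0_nonzero swap.fusion_poly_0_0_nonzero)+
qed

lemma product_half_half:
  assumes u: "u \<in> U (1/2)" and v: "v \<in> U (1/2)"
  shows "mul u v \<in> subspace_sum [U 0, U l, U m]"
proof -
  obtain a b c d where w: "mul u v = a + b + c + d"
    and mem: "a \<in> U 0" "c \<in> U l" "d \<in> U m"
    and vanish: "fusion_poly (1/2) (1/2) (1/2 :: 'k) = 0 \<or> b = 0"
    using peirce_product_components[OF u v] by blast
  have "b = 0"
    using vanish fusion_poly_half_half_nonzero by blast
  then have "mul u v = a + c + d"
    using w by simp
  then show ?thesis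
    using mem by (simp only: sum_of_three_in_subspace_sum)
qed

lemma product_l_m:
  assumes five: "(5 :: 'k) \<noteq> 0" and u: "u \<in> U l" and v: "v \<in> U m"
  shows "mul u v = 0"
proof (cases "(3 :: 'k) = 0")
  case True
  then have "u = 0 \<or> v = 0"
    using eigenvalue_zero_if_three_zero peirce_space_zero_if_eigenvalues_coincide(2)[OF _ u]
      peirce_space_zero_if_eigenvalues_coincide(3)[OF _ v] by blast
  then show ?thesis
    by (auto simp: mul_zero_left mul_zero_right)
next
  case False
  interpret swap: peirce_decomposed_algebra scale mul \<omega> e m l
    by (rule peirce_decomposed_algebra_swap)
  have "fusion_poly l m 0 \<noteq> 0" "fusion_poly l m (1/2) \<noteq> 0" "fusion_poly l m l \<noteq> 0"
    using fusion_poly_l_m_nonzero five False by blast+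
  moreover have "fusion_poly l m m \<noteq> 0"
    using swap.fusion_poly_l_m_nonzero(3) False by (simp add: fusion_poly_commute[of l m])
  moreover obtain a b c d where "mul u v = a + b + c + d"
    "fusion_poly l m 0 = 0 \<or> a = 0" "fusion_poly l m (1/2) = 0 \<or> b = 0"
    "fusion_poly l m l = 0 \<or> c = 0" "fusion_poly l m m = 0 \<or> d = 0"
    using peirce_product_components[OF u v] by blast
  ultimately show ?thesis by simp
qed

text \<open>
  If \<open>l = 0\<close>, the space itself is zero. Otherwise characteristic 3 forces \<open>m = 0\<close>, and the components for
  the eigenvalues \<open>0\<close> and \<open>m\<close> vanish because these two spaces coincide; in any other characteristic they
  vanish because the polynomial does not.
\<close>

lemma product_l_l:
  assumes p: "(163 :: 'k) \<noteq> 0" and u: "u \<in> U l" and v: "v \<in> U l"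
  shows "mul u v = 0"
proof (cases "l = 0")
  case True
  then show ?thesis
    using peirce_space_zero_if_eigenvalues_coincide(2)[OF _ u] by (simp add: mul_zero_left)
next
  case False
  obtain a b c d where w: "mul u v = a + b + c + d"
    and mem: "a \<in> U 0" "b \<in> U (1/2)" "c \<in> U l" "d \<in> U m"
    and vanish: "fusion_poly l l 0 = 0 \<or> a = 0" "fusion_poly l l (1/2) = 0 \<or> b = 0"
      "fusion_poly l l l = 0 \<or> c = 0" "fusion_poly l l m = 0 \<or> d = 0"
    using peirce_product_components[OF u v] by blast
  have "a = 0" "d = 0"
    using vanish(1,4) fusion_poly_l_l_nonzero(1,3) eigenvalue_zero_if_three_zero False
      peirce_space_zero_if_eigenvalues_coincide mem by blast+
  moreover have "b = 0"
    using vanish(2) fusion_poly_l_l_nonzero(2) False by blast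
  moreover have "c = 0"
    using vanish(3) fusion_poly_l_l_nonzero(4) p by blast
  ultimately show ?thesis
    by (simp add: w)
qed

lemma product_0_half:
  assumes u: "u \<in> U 0" and v: "v \<in> U (1/2)"
  shows "mul u v \<in> subspace_sum [U (1/2), U l, U m]"
proof -
  obtain a b c d where w: "mul u v = a + b + c + d"
    and mem: "a \<in> U 0" "b \<in> U (1/2)" "c \<in> U l" "d \<in> U m"
    and vanish: "fusion_poly 0 (1/2) (0 :: 'k) = 0 \<or> a = 0"
    using peirce_product_components[OF u v] by blast
  have "a = 0"
    using vanish eigenvalue_zero_if_three_zero peirce_space_zero_if_eigenvalues_coincide(1) mem(1)
    by (cases "(3 :: 'k) = 0") (auto simp: fusion_poly_0_half_at_0)
  then have "mul u v = b + c + d"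
    using w by simp
  then show ?thesis
    using mem by (simp only: sum_of_three_in_subspace_sum)
qed

lemma product_l_half:
  assumes u: "u \<in> U l" and v: "v \<in> U (1/2)"
  shows "mul u v \<in> subspace_sum [U (1/2), U 0, U m]"
proof -
  obtain a b c d where w: "mul u v = a + b + c + d"
    and mem: "a \<in> U 0" "b \<in> U (1/2)" "c \<in> U l" "d \<in> U m"
    and vanish: "fusion_poly l (1/2) l = 0 \<or> c = 0"
    using peirce_product_components[OF u v] by blast
  have "c = 0"
    using vanish fusion_poly_l_half_nonzero peirce_space_zero_if_eigenvalues_coincide(2) mem(3) by blast
  then have "mul u v = b + a + d"
    using w by (simp add: add.commute)
  then show ?thesis
    using mem by (simp only: sum_of_three_in_subspace_sum)
qed

lemma product_0_l:
  assumes u: "u \<in> U 0" and v: "v \<in> U l"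
  shows "mul u v \<in> U (1/2)"
proof (cases "m = 0")
  case True
  then show ?thesis
    using peirce_space_zero_if_eigenvalues_coincide(1)[OF _ u] by (simp add: mul_zero_left zero_mem)
next
  case False
  then show ?thesis
    by (intro product_in_U_half[OF u v] fusion_poly_0_l_nonzero)
qed

end

section \<open>From the direct sum to the multiplication rules\<close>

lemma of_nat_prime_nonzero:
  assumes "prime p" "CHAR('k::field) \<noteq> p"
  shows "of_nat p \<noteq> (0 :: 'k)"
  using assms by (auto simp: of_nat_eq_0_iff_char_dvd prime_nat_iff)

lemma peirce_decomposed_algebra_of_direct_sum:
  fixes scale :: "'k::field \<Rightarrow> 'a::ab_group_add \<Rightarrow> 'a"
  assumes baric: "baric_algebra scale mul \<omega>"
    and two: "(2 :: 'k) \<noteq> 0" and inf: "infinite (UNIV :: 'k set)"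
    and identity: "\<And>x. scale 2 (mul (principal_power mul x 2) (principal_power mul x 4)) =
        scale (\<omega> x ^ 2) (principal_power mul x 4) + scale (\<omega> x ^ 4) (principal_power mul x 2)"
    and idem: "mul e e = e"
    and eigenvalues: "2 * (l + m) = -1" "2 * (l * m) = 3"
    and A: "A = peirce_space scale mul \<omega> e"
    and decomposition: "is_direct_sum UNIV [range (\<lambda>c. scale c e), A 0, A (1/2), A l, A m]"
  shows "peirce_decomposed_algebra scale mul \<omega> e l m"
proof -
  interpret baric_algebra scale mul \<omega> by (rule baric)
  let ?Us = "[range (\<lambda>c. scale c e), A 0, A (1/2), A l, A m]"
  have listset_iff: "xs \<in> listset ?Us \<longleftrightarrow> (\<exists>r a b c d. xs = [scale r e, a, b, c, d] \<and>
      a \<in> A 0 \<and> b \<in> A (1/2) \<and> c \<in> A l \<and> d \<in> A m)" for xs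
    by (auto simp: set_Cons_def image_def)
  have kernel: "\<omega> x = 0" if "x \<in> A \<gamma>" for x \<gamma>
    using that by (simp add: A peirce_space_def)
  have zero: "0 \<in> A \<gamma>" for \<gamma>
    unfolding A using subspace_peirce_space by (rule subspace_0)
  have sums: "\<exists>r a b c d. x = scale r e + a + b + c + d \<and>
      a \<in> A 0 \<and> b \<in> A (1/2) \<and> c \<in> A l \<and> d \<in> A m" for x
  proof -
    have "x \<in> sum_list ` listset ?Us"
      using decomposition by (simp only: is_direct_sum_def bij_betw_def) simp
    then obtain xs where "xs \<in> listset ?Us" and x: "x = sum_list xs" by blast
    then show ?thesis
      unfolding listset_iff by (auto simp: add.assoc) blast
  qed
  \<comment> \<open>If \<open>e\<close> had weight zero, all five summands would lie in the kernel of \<open>\<omega>\<close>.\<close>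
  have "\<omega> e \<noteq> 0"
  proof
    assume we: "\<omega> e = 0"
    have "\<omega> x = 0" for x
      using sums[of x] kernel by (auto simp: weight_add weight_scale we)
    then show False using weight_nonzero by simp
  qed
  moreover have "\<omega> e * \<omega> e = \<omega> e"
    using weight_mul[of e e] idem by simp
  ultimately have we: "\<omega> e = 1" by simp
  show ?thesis
  proof unfold_locales
    fix x assume "\<omega> x = 0"
    moreover obtain r a b c d where x: "x = scale r e + a + b + c + d"
      and mem: "a \<in> A 0" "b \<in> A (1/2)" "c \<in> A l" "d \<in> A m"
      using sums by blast
    ultimately have "r = 0"
      by (simp add: weight_add weight_scale we kernel[OF mem(1)] kernel[OF mem(2)]
          kernel[OF mem(3)] kernel[OF mem(4)])
    then have "x = a + b + c + d"
      using x by simp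
    then show "\<exists>a b c d. x = a + b + c + d \<and> a \<in> peirce_space scale mul \<omega> e 0 \<and>
        b \<in> peirce_space scale mul \<omega> e (1/2) \<and> c \<in> peirce_space scale mul \<omega> e l \<and>
        d \<in> peirce_space scale mul \<omega> e m"
      using mem unfolding A by blast
  next
    fix a b c d
    assume sum: "a + b + c + d = 0" and mem: "a \<in> peirce_space scale mul \<omega> e 0"
      "b \<in> peirce_space scale mul \<omega> e (1/2)" "c \<in> peirce_space scale mul \<omega> e l"
      "d \<in> peirce_space scale mul \<omega> e m"
    have "[0, a, b, c, d] \<in> listset ?Us" "[0, 0, 0, 0, 0] \<in> listset ?Us"
      unfolding listset_iff using mem zero scale_zero_left[of e] by (metis A)+
    moreover have "sum_list [0, a, b, c, d] = sum_list [0, 0, 0, 0, 0]"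
      using sum by (simp add: add.assoc)
    ultimately have "[0, a, b, c, d] = [0, 0, 0, 0, 0]"
      using decomposition unfolding is_direct_sum_def bij_betw_def by (metis inj_onD)
    then show "a = 0 \<and> b = 0 \<and> c = 0 \<and> d = 0" by simp
  qed (use two inf identity idem we eigenvalues in simp_all)
qed

theorem theorem3p3:
  fixes scale :: "'k::alg_closed_field \<Rightarrow> 'a::ab_group_add \<Rightarrow> 'a"
    and mul :: "'a \<Rightarrow> 'a \<Rightarrow> 'a"
    and \<omega> :: "'a \<Rightarrow> 'k"
    and e :: 'a
    and s l l' :: 'k
    and A :: "'k \<Rightarrow> 'a set"
  assumes char: "CHAR('k) \<noteq> 2"
    and baric: "baric_algebra scale mul \<omega>"
    and identity: "\<And>x. scale 2 (mul (principal_power mul x 2) (principal_power mul x 4)) =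
        scale (\<omega> x ^ 2) (principal_power mul x 4) + scale (\<omega> x ^ 4) (principal_power mul x 2)"
    and idempotent: "mul e e = e" "e \<noteq> 0"
    and sqrt: "s ^ 2 = -23"
    and l: "l = (-1 - s) / 4"
    and l': "l' = (-1 + s) / 4"
    and A: "A = peirce_space scale mul \<omega> e"
    and decomposition: "is_direct_sum UNIV [range (\<lambda>c. scale c e), A 0, A (1/2), A l, A l']"
  shows "subspace_product scale mul (A 0) (A 0) \<subseteq> A (1/2) \<and>
    subspace_product scale mul (A (1/2)) (A (1/2)) \<subseteq> subspace_sum [A 0, A l, A l'] \<and>
    (CHAR('k) \<noteq> 5 \<longrightarrow> subspace_product scale mul (A l) (A l') = {0}) \<and>
    (CHAR('k) \<noteq> 163 \<longrightarrow> subspace_product scale mul (A l) (A l) = {0}) \<and>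
    (CHAR('k) \<noteq> 163 \<longrightarrow> subspace_product scale mul (A l') (A l') = {0}) \<and>
    subspace_product scale mul (A 0) (A (1/2)) \<subseteq> subspace_sum [A (1/2), A l, A l'] \<and>
    subspace_product scale mul (A l) (A (1/2)) \<subseteq> subspace_sum [A (1/2), A 0, A l'] \<and>
    subspace_product scale mul (A l') (A (1/2)) \<subseteq> subspace_sum [A (1/2), A 0, A l] \<and>
    subspace_product scale mul (A 0) (A l) \<subseteq> A (1/2) \<and>
    subspace_product scale mul (A 0) (A l') \<subseteq> A (1/2)"
proof -
  have two: "(2 :: 'k) \<noteq> 0"
    using of_nat_prime_nonzero[of 2, OF _ char] by simp
  then have four: "(4 :: 'k) \<noteq> 0"
    using mult_eq_0_iff[of "2 :: 'k" 2] by simp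
  then have l4: "4 * l = -1 - s" and l4': "4 * l' = -1 + s"
    by (simp_all add: l l')
  have "2 * (2 * (l + l')) = 2 * -1"
    using l4 l4' by algebra
  then have sum: "2 * (l + l') = -1"
    using two by (metis mult_left_cancel)
  have "8 * (2 * (l * l')) = 8 * 3"
    using l4 l4' sqrt by algebra
  moreover have "(8 :: 'k) \<noteq> 0"
    using two four mult_eq_0_iff[of "2 :: 'k" 4] by simp
  ultimately have prod: "2 * (l * l') = 3"
    by (metis mult_left_cancel)
  interpret peirce_decomposed_algebra scale mul \<omega> e l l'
    by (rule peirce_decomposed_algebra_of_direct_sum[OF baric two infinite_UNIV_alg_closed
          identity idempotent(1) sum prod A decomposition])
  interpret swap: peirce_decomposed_algebra scale mul \<omega> e l' l
    by (rule peirce_decomposed_algebra_swap)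
  have subspaces: "subspace (A \<gamma>)" for \<gamma>
    unfolding A by (rule subspace_peirce_space)
  have sums: "subspace (subspace_sum [A \<alpha>, A \<beta>, A \<gamma>])" for \<alpha> \<beta> \<gamma>
    by (rule subspace_subspace_sum) (auto simp: subspaces)
  have five: "(5 :: 'k) \<noteq> 0" if "CHAR('k) \<noteq> 5"
    using of_nat_prime_nonzero[of 5, OF _ that] by simp
  have p163: "(163 :: 'k) \<noteq> 0" if "CHAR('k) \<noteq> 163"
    using of_nat_prime_nonzero[of 163, OF _ that] by simp
  show ?thesis
  proof (intro conjI impI)
    show "subspace_product scale mul (A 0) (A 0) \<subseteq> A (1/2)"
      using product_0_0 by (intro subspace_product_subset subspaces) (simp add: A)
    show "subspace_product scale mul (A (1/2)) (A (1/2)) \<subseteq> subspace_sum [A 0, A l, A l']"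
      using product_half_half by (intro subspace_product_subset sums) (simp add: A)
    show "subspace_product scale mul (A l) (A l') = {0}" if "CHAR('k) \<noteq> 5"
      using product_l_m[OF five[OF that]] by (intro subspace_product_eq_0) (simp add: A)
    show "subspace_product scale mul (A l) (A l) = {0}" if "CHAR('k) \<noteq> 163"
      using product_l_l[OF p163[OF that]] by (intro subspace_product_eq_0) (simp add: A)
    show "subspace_product scale mul (A l') (A l') = {0}" if "CHAR('k) \<noteq> 163"
      using swap.product_l_l[OF p163[OF that]] by (intro subspace_product_eq_0) (simp add: A)
    show "subspace_product scale mul (A 0) (A (1/2)) \<subseteq> subspace_sum [A (1/2), A l, A l']"
      using product_0_half by (intro subspace_product_subset sums) (simp add: A)
    show "subspace_product scale mul (A l) (A (1/2)) \<subseteq> subspace_sum [A (1/2), A 0, A l']"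
      using product_l_half by (intro subspace_product_subset sums) (simp add: A)
    show "subspace_product scale mul (A l') (A (1/2)) \<subseteq> subspace_sum [A (1/2), A 0, A l]"
      using swap.product_l_half by (intro subspace_product_subset sums) (simp add: A)
    show "subspace_product scale mul (A 0) (A l) \<subseteq> A (1/2)"
      using product_0_l by (intro subspace_product_subset subspaces) (simp add: A)
    show "subspace_product scale mul (A 0) (A l') \<subseteq> A (1/2)"
      using swap.product_0_l by (intro subspace_product_subset subspaces) (simp add: A)
  qed
qed

end
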